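(* Let $X$ be a compact metric space, $T\colon X\to X$ a homeomorphism, $\mu\in\mathcal{M}_T(X)$ a $T$-invariant Borel probability measure, $\xi\in\mathbb{S}^1$, and $x\in X$ a $\mu$-generic point. Then either $A[f,\bar\xi](x)$ exists and equals $0$ for every $f\in C(X)$, or $\xi$ is an eigenvalue of the Koopman operator $U_T$ on $L^2(X,\mu)$ and there exists a corresponding eigenfunction $e_\xi\in L^2(X,\mu)$ (in particular $e_\xi\ne0$ and $U_Te_\xi=\xi e_\xi$) satisfying $\|e_\xi\|_2\le1$ and $$A[f,\bar\xi](x)=\langle f,e_\xi\rangle=\int f\,\overline{e_\xi}\,d\mu$$ for every $f\in C(X)$ such that $A[f,\bar\xi](x)$ exists.
   Context: $\mathcal{M}_T(X)$ denotes the set of $T$-invariant Borel probability measures on $X$; $C(X)$ denotes the continuous functions $X\to\mathbb{C}$; $\mathbb{S}^1=\{z\in\mathbb{C}:|z|=1\}$; $U_Tf=f\circ T$. A point $x\in X$ is $\mu$-generic if $\frac1n\sum_{j=0}^{n-1}f(T^j(x))\to\int f\,d\mu$ for every $f\in C(X)$. For $f\in C(X)$ let $A_n[f,\bar\xi](x)=\frac1n\sum_{j=0}^{n-1}\xi^{-j}f(T^j(x))$, and $A[f,\bar\xi](x)=\lim_{n\to\infty}A_n[f,\bar\xi](x)$ whenever this limit exists. *)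

theory Defs
  imports "HOL-Probability.Probability"
begin

text \<open>The space X is the whole carrier of a metric type; compactness is stated as
  \<^prop>\<open>compact (UNIV :: 'a::metric_space set)\<close>.\<close>

definition invariant_prob_measures :: "('a::metric_space \<Rightarrow> 'a) \<Rightarrow> 'a measure set" where
  "invariant_prob_measures T =
     {\<mu>. sets \<mu> = sets borel \<and> prob_space \<mu> \<and> distr \<mu> \<mu> T = \<mu>}"

definition generic_point :: "('a::metric_space \<Rightarrow> 'a) \<Rightarrow> 'a measure \<Rightarrow> 'a \<Rightarrow> bool" where
  "generic_point T \<mu> x \<longleftrightarrow>
     (\<forall>f :: 'a \<Rightarrow> complex. continuous_on UNIV f \<longrightarrow>
        (\<lambda>n. (\<Sum>j<n. f ((T ^^ j) x)) / of_nat n) \<longlonglongrightarrow> (LINT y|\<mu>. f y))"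

text \<open>\<open>twisted_avg T \<xi> f n x\<close> is \<open>A\<^sub>n[f, cnj \<xi>](x)\<close>: the argument \<open>\<xi>\<close> is the
  number itself, and the weights are its powers with exponent \<open>-j\<close>.\<close>

definition twisted_avg ::
    "('a \<Rightarrow> 'a) \<Rightarrow> complex \<Rightarrow> ('a \<Rightarrow> complex) \<Rightarrow> nat \<Rightarrow> 'a \<Rightarrow> complex" where
  "twisted_avg T \<xi> f n x = (\<Sum>j<n. \<xi> powi (- int j) * f ((T ^^ j) x)) / of_nat n"

definition twisted_lim_exists ::
    "('a \<Rightarrow> 'a) \<Rightarrow> complex \<Rightarrow> ('a \<Rightarrow> complex) \<Rightarrow> 'a \<Rightarrow> bool" where
  "twisted_lim_exists T \<xi> f x \<longleftrightarrow> convergent (\<lambda>n. twisted_avg T \<xi> f n x)"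

definition twisted_lim :: "('a \<Rightarrow> 'a) \<Rightarrow> complex \<Rightarrow> ('a \<Rightarrow> complex) \<Rightarrow> 'a \<Rightarrow> complex" where
  "twisted_lim T \<xi> f x = lim (\<lambda>n. twisted_avg T \<xi> f n x)"

text \<open>Elements of \<open>L\<^sup>2(X, \<mu>)\<close> are handled through square-integrable representatives;
  equality in \<open>L\<^sup>2\<close> is equality \<open>\<mu>\<close>-almost everywhere.\<close>

definition L2_space :: "'a measure \<Rightarrow> ('a \<Rightarrow> complex) set" where
  "L2_space \<mu> = {f \<in> borel_measurable \<mu>. integrable \<mu> (\<lambda>y. (cmod (f y))\<^sup>2)}"

definition L2_norm :: "'a measure \<Rightarrow> ('a \<Rightarrow> complex) \<Rightarrow> real" where
  "L2_norm \<mu> f = sqrt (LINT y|\<mu>. (cmod (f y))\<^sup>2)"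

definition L2_inner :: "'a measure \<Rightarrow> ('a \<Rightarrow> complex) \<Rightarrow> ('a \<Rightarrow> complex) \<Rightarrow> complex" where
  "L2_inner \<mu> f g = (LINT y|\<mu>. f y * cnj (g y))"

definition koopman :: "('a \<Rightarrow> 'a) \<Rightarrow> ('a \<Rightarrow> complex) \<Rightarrow> 'a \<Rightarrow> complex" where
  "koopman T f = f \<circ> T"

definition koopman_eigenfunction ::
    "('a \<Rightarrow> 'a) \<Rightarrow> 'a measure \<Rightarrow> complex \<Rightarrow> ('a \<Rightarrow> complex) \<Rightarrow> bool" where
  "koopman_eigenfunction T \<mu> \<xi> e \<longleftrightarrow>
     e \<in> L2_space \<mu> \<and> \<not> (AE y in \<mu>. e y = 0) \<and> (AE y in \<mu>. koopman T e y = \<xi> * e y)"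

definition koopman_eigenvalue :: "('a \<Rightarrow> 'a) \<Rightarrow> 'a measure \<Rightarrow> complex \<Rightarrow> bool" where
  "koopman_eigenvalue T \<mu> \<xi> \<longleftrightarrow> (\<exists>e. koopman_eigenfunction T \<mu> \<xi> e)"

end

theory Submission
  imports Defs
begin

text \<open>
  Suppose the averages of some continuous \<open>f\<^sub>0\<close> do not tend to \<open>0\<close>. Then they stay away from \<open>0\<close>
  infinitely often, and since all averages are bounded, Tychonoff's theorem gives a filter \<open>F\<close>
  refining those indices along which \<open>A\<^sub>n[f, cnj \<xi>](x)\<close> converges to some \<open>l f\<close> for \<^emph>\<open>every\<close>
  continuous \<open>f\<close> at once (\<open>bounded_family_cluster_filter\<close>). Wherever the genuine limit exists, \<open>l\<close>
  agrees with it, and \<open>l f\<^sub>0 \<noteq> 0\<close>.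

  The functional \<open>l\<close> is linear. Because \<open>x\<close> is generic, \<open>\<bar>l f\<bar>\<close> is at most \<open>\<integral>\<bar>f\<bar> d\<mu>\<close>, the limit of the
  averages of \<open>\<bar>f\<bar>\<close>, hence at most \<open>\<parallel>f\<parallel>\<^sub>2\<close> (\<open>twisted_avg_limit_bound\<close>). So \<open>l\<close> is a contraction for
  the seminorm of \<open>L\<^sup>2(\<mu>)\<close>, and the Riesz representation theorem yields \<open>e\<close> of norm at most \<open>1\<close> with
  \<open>l f = \<langle>f, e\<rangle>\<close>. Finally, a shift of the summation index changes an average by a factor \<open>\<xi>\<close> up to
  a boundary term (\<open>twisted_avg_shift\<close>), so \<open>l (f \<circ> T) = \<xi> l f\<close>; this forces \<open>e \<circ> T = \<xi> e\<close>
  almost everywhere, and \<open>l f\<^sub>0 \<noteq> 0\<close> forces \<open>e \<noteq> 0\<close>.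

  The representing \<open>e\<close> is found by minimising \<open>\<parallel>f\<parallel>\<^sup>2 - 2 Re (l f)\<close> over the continuous functions
  themselves (\<open>Riesz_representation_L2_subspace\<close>). It is thus an \<open>L\<^sup>2\<close>-limit of continuous functions
  by construction, and along these approximants identities pass from continuous functions to \<open>e\<close>.
\<close>

section \<open>The inner product on square-integrable functions\<close>

lemma L2_add:
  assumes "f \<in> L2_space M" "g \<in> L2_space M"
  shows "(\<lambda>y. f y + g y) \<in> L2_space M"
proof -
  have [measurable]: "f \<in> borel_measurable M" "g \<in> borel_measurable M"
    using assms by (auto simp: L2_space_def)
  have "integrable M (\<lambda>y. (cmod (f y + g y))\<^sup>2)"
  proof (rule Bochner_Integration.integrable_bound)
    show "integrable M (\<lambda>y. 2 * (cmod (f y))\<^sup>2 + 2 * (cmod (g y))\<^sup>2)"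
      using assms by (auto simp: L2_space_def)
    have "(cmod (a + b))\<^sup>2 \<le> 2 * (cmod a)\<^sup>2 + 2 * (cmod b)\<^sup>2" for a b
    proof -
      have "(cmod (a + b))\<^sup>2 \<le> (cmod a + cmod b)\<^sup>2"
        by (intro power_mono norm_triangle_ineq) auto
      also have "\<dots> \<le> 2 * (cmod a)\<^sup>2 + 2 * (cmod b)\<^sup>2"
        using sum_squares_bound[of "cmod a" "cmod b"] by (simp add: power2_sum)
      finally show ?thesis .
    qed
    then show "AE y in M. norm ((cmod (f y + g y))\<^sup>2) \<le> norm (2 * (cmod (f y))\<^sup>2 + 2 * (cmod (g y))\<^sup>2)"
      by (intro AE_I2) simp
  qed measurable
  then show ?thesis by (simp add: L2_space_def)
qed

lemma L2_scale:
  assumes "f \<in> L2_space M"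
  shows "(\<lambda>y. c * f y) \<in> L2_space M"
  using assms by (auto simp: L2_space_def norm_mult power_mult_distrib)

lemma L2_diff:
  assumes "f \<in> L2_space M" "g \<in> L2_space M"
  shows "(\<lambda>y. f y - g y) \<in> L2_space M"
  using L2_add[OF assms(1) L2_scale[OF assms(2), of "-1"]] by simp

lemma L2_mult_integrable:
  assumes "f \<in> L2_space M" "g \<in> L2_space M"
  shows "integrable M (\<lambda>y. f y * cnj (g y))"
proof (rule Bochner_Integration.integrable_bound)
  have [measurable]: "f \<in> borel_measurable M" "g \<in> borel_measurable M"
    using assms by (auto simp: L2_space_def)
  have [measurable]: "cnj \<in> borel_measurable borel"
    by (intro borel_measurable_continuous_onI continuous_intros)
  show "(\<lambda>y. f y * cnj (g y)) \<in> borel_measurable M"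
    by measurable
  show "integrable M (\<lambda>y. (cmod (f y))\<^sup>2 + (cmod (g y))\<^sup>2)"
    using assms by (auto simp: L2_space_def)
  have "cmod a * cmod b \<le> (cmod a)\<^sup>2 + (cmod b)\<^sup>2" for a b
  proof -
    have "0 \<le> cmod a * cmod b" by simp
    then show ?thesis
      using sum_squares_bound[of "cmod a" "cmod b"] by linarith
  qed
  then show "AE y in M. norm (f y * cnj (g y)) \<le> norm ((cmod (f y))\<^sup>2 + (cmod (g y))\<^sup>2)"
    by (intro AE_I2) (simp add: norm_mult)
qed

lemma L2_inner_scale_left: "L2_inner M (\<lambda>y. c * f y) h = c * L2_inner M f h"
  by (simp add: L2_inner_def mult.assoc)

lemma L2_inner_commute: "L2_inner M g f = cnj (L2_inner M f g)"
  unfolding L2_inner_def Bochner_Integration.integral_cnj[symmetric] by (simp add: mult.commute)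

lemma L2_inner_diff_left:
  assumes "f \<in> L2_space M" "g \<in> L2_space M" "h \<in> L2_space M"
  shows "L2_inner M (\<lambda>y. f y - g y) h = L2_inner M f h - L2_inner M g h"
  using assms by (simp add: L2_inner_def left_diff_distrib L2_mult_integrable)

lemma L2_norm_nonneg: "0 \<le> L2_norm M f"
  by (simp add: L2_norm_def)

lemma L2_norm_sq: "(L2_norm M f)\<^sup>2 = (LINT y|M. (cmod (f y))\<^sup>2)"
  by (simp add: L2_norm_def)

lemma L2_inner_self: "L2_inner M f f = of_real ((L2_norm M f)\<^sup>2)"
  unfolding L2_norm_sq L2_inner_def complex_norm_square[symmetric] integral_complex_of_real ..

lemma L2_norm_scale: "L2_norm M (\<lambda>y. c * f y) = cmod c * L2_norm M f"
  by (simp add: L2_norm_def norm_mult power_mult_distrib real_sqrt_mult)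

lemma L2_norm_sq_add:
  assumes f: "f \<in> L2_space M" and g: "g \<in> L2_space M"
  shows "(L2_norm M (\<lambda>y. f y + g y))\<^sup>2
    = (L2_norm M f)\<^sup>2 + (L2_norm M g)\<^sup>2 + 2 * Re (L2_inner M f g)"
proof -
  define r where "r y = Re (f y * cnj (g y))" for y
  have "(cmod (f y + g y))\<^sup>2 = (cmod (f y))\<^sup>2 + (cmod (g y))\<^sup>2 + 2 * r y" for y
    unfolding r_def cmod_power2 by (simp add: power2_eq_square algebra_simps)
  moreover have "integrable M (\<lambda>y. (cmod (f y))\<^sup>2)" "integrable M (\<lambda>y. (cmod (g y))\<^sup>2)"
    using f g by (auto simp: L2_space_def)
  moreover have "integrable M r"
    unfolding r_def using L2_mult_integrable[OF f g] by (rule integrable_Re)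
  moreover have "Re (L2_inner M f g) = (LINT y|M. r y)"
    unfolding L2_inner_def r_def by (rule integral_Re[symmetric, OF L2_mult_integrable[OF f g]])
  ultimately show ?thesis
    unfolding L2_norm_sq by simp
qed

lemma L2_norm_sq_diff:
  assumes f: "f \<in> L2_space M" and g: "g \<in> L2_space M"
  shows "(L2_norm M (\<lambda>y. f y - g y))\<^sup>2
    = (L2_norm M f)\<^sup>2 + (L2_norm M g)\<^sup>2 - 2 * Re (L2_inner M f g)"
proof -
  have "L2_inner M f (\<lambda>y. - g y) = - L2_inner M f g"
    by (simp add: L2_inner_def)
  moreover have "L2_norm M (\<lambda>y. - g y) = L2_norm M g"
    by (simp add: L2_norm_def)
  ultimately show ?thesis
    using L2_norm_sq_add[OF f L2_scale[OF g, of "-1"]] by simp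
qed

lemma L2_norm_eq_0_iff:
  assumes "f \<in> L2_space M"
  shows "L2_norm M f = 0 \<longleftrightarrow> (AE y in M. f y = 0)"
proof -
  have "L2_norm M f = 0 \<longleftrightarrow> (LINT y|M. (cmod (f y))\<^sup>2) = 0"
    by (simp add: L2_norm_def)
  also have "\<dots> \<longleftrightarrow> (AE y in M. (cmod (f y))\<^sup>2 = 0)"
    using assms by (intro integral_nonneg_eq_0_iff_AE) (auto simp: L2_space_def)
  finally show ?thesis by simp
qed

text \<open>The usual discriminant argument: \<open>\<parallel>f - s\<langle>f, g\<rangle>g\<parallel>\<^sup>2 \<ge> 0\<close> for all real \<open>s\<close>.\<close>

lemma L2_Cauchy_Schwarz:
  assumes f: "f \<in> L2_space M" and g: "g \<in> L2_space M"
  shows "cmod (L2_inner M f g) \<le> L2_norm M f * L2_norm M g"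
proof -
  let ?a = "L2_inner M f g" and ?F = "L2_norm M f" and ?G = "L2_norm M g"
  have nonneg: "0 \<le> ?F\<^sup>2 + s\<^sup>2 * (cmod ?a)\<^sup>2 * ?G\<^sup>2 - 2 * s * (cmod ?a)\<^sup>2" for s :: real
  proof -
    have sg: "(\<lambda>y. (of_real s * ?a) * g y) \<in> L2_space M"
      by (rule L2_scale[OF g])
    have "L2_inner M f (\<lambda>y. (of_real s * ?a) * g y) = cnj (of_real s * ?a) * ?a"
      by (subst L2_inner_commute, subst L2_inner_scale_left) (simp add: L2_inner_commute[of M g f])
    also have "\<dots> = of_real (s * (cmod ?a)\<^sup>2)"
      by (simp only: complex_cnj_mult complex_cnj_complex_of_real of_real_mult complex_norm_square) simp
    finally have "Re (L2_inner M f (\<lambda>y. (of_real s * ?a) * g y)) = s * (cmod ?a)\<^sup>2"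
      by simp
    then show ?thesis
      using L2_norm_sq_diff[OF f sg] zero_le_power2[of "L2_norm M (\<lambda>y. f y - (of_real s * ?a) * g y)"]
      unfolding L2_norm_scale by (simp add: norm_mult power_mult_distrib)
  qed
  show ?thesis
  proof (cases "?G = 0")
    case True
    \<comment> \<open>The quadratic degenerates to a linear function of \<open>s\<close>; being nonnegative, it is constant.\<close>
    have "cmod ?a = 0"
    proof (rule ccontr)
      assume "cmod ?a \<noteq> 0"
      then have "2 * ((?F\<^sup>2 + 1) / (cmod ?a)\<^sup>2) * (cmod ?a)\<^sup>2 = 2 * (?F\<^sup>2 + 1)"
        by simp
      then show False
        using nonneg[of "(?F\<^sup>2 + 1) / (cmod ?a)\<^sup>2"] True zero_le_power2[of ?F]
        by simp
    qed
    then show ?thesis using True by simp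
  next
    case False
    then have "(1 / ?G\<^sup>2)\<^sup>2 * (cmod ?a)\<^sup>2 * ?G\<^sup>2 = (cmod ?a)\<^sup>2 / ?G\<^sup>2"
      by (simp add: power2_eq_square)
    then have "(cmod ?a)\<^sup>2 / ?G\<^sup>2 \<le> ?F\<^sup>2"
      using nonneg[of "1 / ?G\<^sup>2"] by simp
    then have "(cmod ?a)\<^sup>2 \<le> ?F\<^sup>2 * ?G\<^sup>2"
      using False by (simp add: field_simps)
    then show ?thesis
      by (intro power2_le_imp_le[of "cmod ?a" "?F * ?G"]) (auto simp: power_mult_distrib L2_norm_nonneg)
  qed
qed

lemma L2_inner_tendsto:
  assumes "\<And>n. \<phi> n \<in> L2_space M" "e \<in> L2_space M" "g \<in> L2_space M"
    and "(\<lambda>n. L2_norm M (\<lambda>y. \<phi> n y - e y)) \<longlonglongrightarrow> 0"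
  shows "(\<lambda>n. L2_inner M (\<phi> n) g) \<longlonglongrightarrow> L2_inner M e g"
proof -
  have "(\<lambda>n. L2_inner M (\<phi> n) g - L2_inner M e g) \<longlonglongrightarrow> 0"
  proof (rule Lim_null_comparison)
    show "(\<lambda>n. L2_norm M (\<lambda>y. \<phi> n y - e y) * L2_norm M g) \<longlonglongrightarrow> 0"
      using tendsto_mult_right[OF assms(4), of "L2_norm M g"] by simp
    show "\<forall>\<^sub>F n in sequentially. cmod (L2_inner M (\<phi> n) g - L2_inner M e g)
        \<le> L2_norm M (\<lambda>y. \<phi> n y - e y) * L2_norm M g"
      using L2_Cauchy_Schwarz[OF L2_diff[OF assms(1,2)] assms(3)]
      by (simp add: L2_inner_diff_left assms)
  qed
  then show ?thesis by (simp add: LIM_zero_iff)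
qed

lemma L2_norm_tendsto:
  assumes "\<And>n. \<phi> n \<in> L2_space M" "e \<in> L2_space M"
    and "(\<lambda>n. L2_norm M (\<lambda>y. \<phi> n y - e y)) \<longlonglongrightarrow> 0"
  shows "(\<lambda>n. L2_norm M (\<phi> n)) \<longlonglongrightarrow> L2_norm M e"
proof -
  have "(\<lambda>n. (L2_norm M (\<lambda>y. \<phi> n y - e y))\<^sup>2 - (L2_norm M e)\<^sup>2 + 2 * Re (L2_inner M (\<phi> n) e))
      \<longlonglongrightarrow> 0\<^sup>2 - (L2_norm M e)\<^sup>2 + 2 * Re (L2_inner M e e)"
    using L2_inner_tendsto[OF assms(1,2,2,3)] assms(3) by (intro tendsto_intros)
  then have "(\<lambda>n. (L2_norm M (\<phi> n))\<^sup>2) \<longlonglongrightarrow> (L2_norm M e)\<^sup>2"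
    by (simp add: L2_norm_sq_diff assms L2_inner_self)
  from tendsto_real_sqrt[OF this] show ?thesis
    by (simp add: L2_norm_nonneg)
qed

lemma L2_nn_integral:
  assumes "h \<in> L2_space M"
  shows "(\<integral>\<^sup>+y. ennreal ((cmod (h y))\<^sup>2) \<partial>M) = ennreal ((L2_norm M h)\<^sup>2)"
  unfolding L2_norm_sq using assms by (intro nn_integral_eq_integral) (auto simp: L2_space_def)

section \<open>Completeness and Riesz representation\<close>

text \<open>
  With \<open>d\<^sub>n = \<bar>\<phi>\<^sub>n - \<phi>\<^sub>n\<^sub>+\<^sub>1\<bar>\<^sup>2\<close> the series \<open>\<Sum> 4\<^sup>n d\<^sub>n\<close> has finite integral, so it is finite almost
  everywhere and bounds each of its terms; this makes \<open>\<bar>\<phi>\<^sub>n - \<phi>\<^sub>n\<^sub>+\<^sub>1\<bar>\<close> decay like \<open>2\<^sup>-\<^sup>n\<close> pointwise.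
  Squares are weighted, rather than \<open>L\<^sup>1\<close>-norms summed, so that the measure may be infinite. Fatou's
  lemma turns the pointwise limit into an \<open>L\<^sup>2\<close>-limit.
\<close>

lemma L2_fast_Cauchy_converges:
  assumes L2: "\<And>n. \<phi> n \<in> L2_space M"
    and fast: "\<And>n m. n \<le> m \<Longrightarrow> (L2_norm M (\<lambda>y. \<phi> n y - \<phi> m y))\<^sup>2 \<le> (1/8)^n"
  obtains e where "e \<in> L2_space M" "(\<lambda>n. L2_norm M (\<lambda>y. \<phi> n y - e y)) \<longlonglongrightarrow> 0"
proof -
  have [measurable]: "\<phi> n \<in> borel_measurable M" for n
    using L2[of n] by (auto simp: L2_space_def)
  define d where "d n y = (cmod (\<phi> n y - \<phi> (Suc n) y))\<^sup>2" for n y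
  have [measurable]: "d n \<in> borel_measurable M" for n
    unfolding d_def by measurable
  define S where "S y = (\<Sum>n. ennreal (4^n * d n y))" for y
  have "(\<integral>\<^sup>+y. S y \<partial>M) = (\<Sum>n. \<integral>\<^sup>+y. ennreal (4^n * d n y) \<partial>M)"
    unfolding S_def by (rule nn_integral_suminf) measurable
  also have "\<dots> \<le> (\<Sum>n. ennreal ((1/2)^n))"
  proof (rule suminf_le)
    fix n
    have "(\<integral>\<^sup>+y. ennreal (4^n * d n y) \<partial>M) = ennreal (4^n) * ennreal ((L2_norm M (\<lambda>y. \<phi> n y - \<phi> (Suc n) y))\<^sup>2)"
      unfolding L2_nn_integral[OF L2_diff[OF L2 L2], symmetric] d_def
      by (subst nn_integral_cmult[symmetric]) (auto simp: ennreal_mult)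
    also have "\<dots> \<le> ennreal (4^n) * ennreal ((1/8)^n)"
      by (intro mult_left_mono ennreal_leI fast) auto
    also have "\<dots> = ennreal ((1/2)^n)"
      by (simp add: ennreal_mult[symmetric] power_mult_distrib[symmetric])
    finally show "(\<integral>\<^sup>+y. ennreal (4^n * d n y) \<partial>M) \<le> ennreal ((1/2)^n)" .
  qed auto
  also have "\<dots> < \<infinity>"
    by (subst suminf_ennreal2) (auto intro!: summable_geometric)
  finally have "AE y in M. S y \<noteq> \<infinity>"
    unfolding S_def by (intro nn_integral_PInf_AE) auto
  then have conv: "AE y in M. convergent (\<lambda>n. \<phi> n y)"
  proof eventually_elim
    case (elim y)
    then obtain C where C: "S y = ennreal C" "0 \<le> C"
      by (cases "S y") auto
    have bound: "norm (\<phi> (Suc n) y - \<phi> n y) \<le> sqrt C * (1/2)^n" for n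
    proof -
      have "ennreal (4^n * d n y) = (\<Sum>k\<in>{n}. ennreal (4^k * d k y))"
        by simp
      also have "\<dots> \<le> S y"
        unfolding S_def by (rule sum_le_suminf) auto
      finally have "4^n * d n y \<le> C"
        using C by simp
      then have "sqrt (4^n * d n y) \<le> sqrt C"
        by simp
      moreover have "sqrt (4^n * d n y) = 2^n * cmod (\<phi> (Suc n) y - \<phi> n y)"
        by (simp add: d_def real_sqrt_mult real_sqrt_power norm_minus_commute)
      ultimately have "2^n * cmod (\<phi> (Suc n) y - \<phi> n y) \<le> sqrt C"
        by linarith
      then show ?thesis
        by (simp add: field_simps power_divide)
    qed
    have "summable (\<lambda>n. \<phi> (Suc n) y - \<phi> n y)"
      by (rule summable_comparison_test'[of "\<lambda>n. sqrt C * (1/2)^n" 0])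
        (use bound in \<open>auto intro!: summable_mult summable_geometric\<close>)
    then have "convergent (\<lambda>n. \<phi> n y - \<phi> 0 y)"
      unfolding summable_iff_convergent sum_lessThan_telescope[of "\<lambda>n. \<phi> n y"] .
    then have "convergent (\<lambda>n. (\<phi> n y - \<phi> 0 y) + \<phi> 0 y)"
      by (intro convergent_add convergent_const)
    then show ?case by simp
  qed
  define e where "e y = lim (\<lambda>n. \<phi> n y)" for y
  have [measurable]: "e \<in> borel_measurable M"
    unfolding e_def by measurable
  have lim: "AE y in M. (\<lambda>n. \<phi> n y) \<longlonglongrightarrow> e y"
    using conv by eventually_elim (simp add: e_def convergent_LIMSEQ_iff)
  have fatou: "(\<integral>\<^sup>+y. ennreal ((cmod (\<phi> n y - e y))\<^sup>2) \<partial>M) \<le> ennreal ((1/8)^n)" for n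
  proof -
    have "(\<integral>\<^sup>+y. ennreal ((cmod (\<phi> n y - e y))\<^sup>2) \<partial>M)
        = (\<integral>\<^sup>+y. liminf (\<lambda>m. ennreal ((cmod (\<phi> n y - \<phi> m y))\<^sup>2)) \<partial>M)"
    proof (rule nn_integral_cong_AE, use lim in eventually_elim)
      case (elim y)
      then have "(\<lambda>m. ennreal ((cmod (\<phi> n y - \<phi> m y))\<^sup>2)) \<longlonglongrightarrow> ennreal ((cmod (\<phi> n y - e y))\<^sup>2)"
        by (intro tendsto_intros)
      from lim_imp_Liminf[OF sequentially_bot this] show ?case by simp
    qed
    also have "\<dots> \<le> liminf (\<lambda>m. \<integral>\<^sup>+y. ennreal ((cmod (\<phi> n y - \<phi> m y))\<^sup>2) \<partial>M)"
      by (rule nn_integral_liminf) measurable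
    also have "\<dots> = liminf (\<lambda>m. ennreal ((L2_norm M (\<lambda>y. \<phi> n y - \<phi> m y))\<^sup>2))"
      by (simp add: L2_nn_integral[OF L2_diff[OF L2 L2]])
    also have "\<dots> \<le> liminf (\<lambda>m. ennreal ((1/8)^n))"
      by (intro Liminf_mono eventually_sequentiallyI[of n] ennreal_leI fast)
    finally show ?thesis by (simp add: Liminf_const)
  qed
  have diff: "(\<lambda>y. \<phi> n y - e y) \<in> L2_space M" for n
  proof -
    have "integrable M (\<lambda>y. (cmod (\<phi> n y - e y))\<^sup>2)"
      using fatou[of n] by (intro integrableI_bounded) (auto simp: le_less_trans)
    then show ?thesis by (simp add: L2_space_def)
  qed
  have "e \<in> L2_space M"
    using L2_diff[OF L2[of 0] diff[of 0]] by simp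
  moreover have "(\<lambda>n. L2_norm M (\<lambda>y. \<phi> n y - e y)) \<longlonglongrightarrow> 0"
  proof -
    have "(L2_norm M (\<lambda>y. \<phi> n y - e y))\<^sup>2 \<le> (1/8)^n" for n
      using fatou[of n] unfolding L2_nn_integral[OF diff] by simp
    then have "(\<lambda>n. (L2_norm M (\<lambda>y. \<phi> n y - e y))\<^sup>2) \<longlonglongrightarrow> 0"
      by (intro tendsto_sandwich[OF _ _ tendsto_const LIMSEQ_power_zero[of "1/8::real"]]) auto
    from tendsto_real_sqrt[OF this] show ?thesis
      by (simp add: L2_norm_nonneg)
  qed
  ultimately show thesis by (rule that)
qed

text \<open>
  Minimise \<open>J f = \<parallel>f\<parallel>\<^sup>2 - 2 Re (l f)\<close> over \<open>V\<close>. The bound on \<open>l\<close> keeps \<open>J\<close> bounded below, the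
  parallelogram law makes minimising sequences Cauchy, and the first variation of \<open>J\<close> at the limit
  \<open>e\<close> (which need not lie in \<open>V\<close>) says that \<open>\<langle>-, e\<rangle>\<close> represents \<open>l\<close>. The approximating
  sequence is part of the result because it places \<open>e\<close> in the closure of \<open>V\<close>.
\<close>

theorem Riesz_representation_L2_subspace:
  fixes l :: "('a \<Rightarrow> complex) \<Rightarrow> complex"
  assumes VL2: "\<And>f. f \<in> V \<Longrightarrow> f \<in> L2_space M" and V: "V \<noteq> {}"
    and Vadd: "\<And>f g. f \<in> V \<Longrightarrow> g \<in> V \<Longrightarrow> (\<lambda>y. f y + g y) \<in> V"
    and Vscale: "\<And>c f. f \<in> V \<Longrightarrow> (\<lambda>y. c * f y) \<in> V"
    and ladd: "\<And>f g. f \<in> V \<Longrightarrow> g \<in> V \<Longrightarrow> l (\<lambda>y. f y + g y) = l f + l g"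
    and lscale: "\<And>c f. f \<in> V \<Longrightarrow> l (\<lambda>y. c * f y) = c * l f"
    and lbound: "\<And>f. f \<in> V \<Longrightarrow> cmod (l f) \<le> C * L2_norm M f" and C: "0 \<le> C"
  obtains e \<phi> where "e \<in> L2_space M" "L2_norm M e \<le> C" "\<And>f. f \<in> V \<Longrightarrow> l f = L2_inner M f e"
    "\<And>n. \<phi> n \<in> V" "(\<lambda>n. L2_norm M (\<lambda>y. \<phi> n y - e y)) \<longlonglongrightarrow> 0"
proof -
  define J where "J f = (L2_norm M f)\<^sup>2 - 2 * Re (l f)" for f
  have "bdd_below (J ` V)"
  proof (rule bdd_belowI2)
    fix f assume f: "f \<in> V"
    have "Re (l f) \<le> C * L2_norm M f"
      using lbound[OF f] complex_Re_le_cmod[of "l f"] by linarith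
    moreover have "0 \<le> (L2_norm M f - C)\<^sup>2" by simp
    ultimately show "- C\<^sup>2 \<le> J f"
      by (simp add: J_def power2_diff algebra_simps)
  qed
  then have m: "(INF f\<in>V. J f) \<le> J f" if "f \<in> V" for f
    using that by (rule cINF_lower)
  define m where "m = (INF f\<in>V. J f)"
  \<comment> \<open>The tolerance is chosen so that the minimising sequence is fast Cauchy without passing to a
    subsequence: \<open>\<parallel>\<phi>\<^sub>n - \<phi>\<^sub>k\<parallel>\<^sup>2 = 2 J \<phi>\<^sub>n + 2 J \<phi>\<^sub>k - 4 J ((\<phi>\<^sub>n + \<phi>\<^sub>k) / 2)\<close>.\<close>
  have "\<exists>f\<in>V. J f < m + (1/8)^n / 4" for n
  proof (rule ccontr)
    assume "\<not> ?thesis"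
    then have "m + (1/8::real)^n / 4 \<le> m"
      using cINF_greatest[OF V, of "m + (1/8)^n / 4" J] m_def by (force simp: not_less)
    moreover have "0 < (1/8::real)^n" by simp
    ultimately show False by linarith
  qed
  then obtain \<phi> where \<phi>: "\<And>n. \<phi> n \<in> V" "\<And>n. J (\<phi> n) < m + (1/8)^n / 4"
    by metis
  have "(L2_norm M (\<lambda>y. \<phi> n y - \<phi> k y))\<^sup>2 \<le> (1/8)^n" if "n \<le> k" for n k
  proof -
    define h where "h y = (1/2) * (\<phi> n y + \<phi> k y)" for y
    have sum: "(\<lambda>y. \<phi> n y + \<phi> k y) \<in> V"
      by (intro Vadd \<phi>)
    have "h \<in> V"
      unfolding h_def by (intro Vscale sum)
    then have "m \<le> J h"
      unfolding m_def by (rule m)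
    moreover have "L2_norm M h = L2_norm M (\<lambda>y. \<phi> n y + \<phi> k y) / 2"
      unfolding h_def L2_norm_scale by simp
    moreover have "l h = (l (\<phi> n) + l (\<phi> k)) / 2"
      unfolding h_def using lscale[OF sum, of "1/2"] by (simp add: ladd \<phi>)
    ultimately have "m \<le> (L2_norm M (\<lambda>y. \<phi> n y + \<phi> k y))\<^sup>2 / 4 - (Re (l (\<phi> n)) + Re (l (\<phi> k)))"
      by (simp add: J_def power_divide add_divide_distrib)
    moreover have "(1/8::real)^k \<le> (1/8)^n"
      using that by (intro power_decreasing) auto
    ultimately show ?thesis
      using \<phi>(2)[of n] \<phi>(2)[of k] L2_norm_sq_add[OF VL2[OF \<phi>(1)] VL2[OF \<phi>(1)], of n k]
        L2_norm_sq_diff[OF VL2[OF \<phi>(1)] VL2[OF \<phi>(1)], of n k]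
      unfolding J_def by linarith
  qed
  then obtain e where e: "e \<in> L2_space M" "(\<lambda>n. L2_norm M (\<lambda>y. \<phi> n y - e y)) \<longlonglongrightarrow> 0"
    by (rule L2_fast_Cauchy_converges[OF VL2[OF \<phi>(1)]])
  have rep: "l f = L2_inner M f e" if f: "f \<in> V" for f
  proof -
    define w where "w = l f - L2_inner M f e"
    have variation: "2 * Re (t * w) \<le> (cmod t)\<^sup>2 * (L2_norm M f)\<^sup>2" for t
    proof -
      have tf: "(\<lambda>y. t * f y) \<in> V"
        by (rule Vscale[OF f])
      have "2 * Re (t * l f) - 2 * Re (t * cnj (L2_inner M (\<phi> n) f)) \<le> (1/8)^n / 4 + (cmod t)\<^sup>2 * (L2_norm M f)\<^sup>2" for n
      proof -
        have "(\<lambda>y. \<phi> n y + t * f y) \<in> V"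
          by (intro Vadd \<phi> tf)
        then have "m \<le> J (\<lambda>y. \<phi> n y + t * f y)"
          unfolding m_def by (rule m)
        moreover have "Re (L2_inner M (\<phi> n) (\<lambda>y. t * f y)) = Re (t * cnj (L2_inner M (\<phi> n) f))"
          by (subst L2_inner_commute, subst L2_inner_scale_left) (simp add: L2_inner_commute[of M f "\<phi> n"])
        ultimately show ?thesis
          using \<phi>(2)[of n] L2_norm_sq_add[OF VL2[OF \<phi>(1)] VL2[OF tf], of n]
          by (simp add: J_def ladd[OF \<phi>(1) tf] lscale[OF f] L2_norm_scale power_mult_distrib)
      qed
      then have "2 * Re (t * l f) - 2 * Re (t * cnj (L2_inner M e f)) \<le> 0 / 4 + (cmod t)\<^sup>2 * (L2_norm M f)\<^sup>2"
        by (intro LIMSEQ_le[of "\<lambda>n. 2 * Re (t * l f) - 2 * Re (t * cnj (L2_inner M (\<phi> n) f))" _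
              "\<lambda>n. (1/8)^n / 4 + (cmod t)\<^sup>2 * (L2_norm M f)\<^sup>2"] tendsto_intros LIMSEQ_power_zero
            L2_inner_tendsto[OF VL2[OF \<phi>(1)] e(1) VL2[OF f] e(2)]) auto
      then show ?thesis
        by (simp add: w_def right_diff_distrib flip: L2_inner_commute)
    qed
    \<comment> \<open>For \<open>t = s cnj w\<close> the left side is linear and the right side quadratic in \<open>s\<close>, so a small
      \<open>s > 0\<close> is contradictory unless \<open>w = 0\<close>.\<close>
    define s where "s = 1 / (1 + (L2_norm M f)\<^sup>2)"
    have s: "0 < s" "s * (L2_norm M f)\<^sup>2 \<le> 1"
      by (auto simp: s_def field_simps add_pos_nonneg)
    have "Re ((of_real s * cnj w) * w) = s * (cmod w)\<^sup>2"
      unfolding cmod_power2 by (simp add: power2_eq_square algebra_simps)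
    then have "2 * (s * (cmod w)\<^sup>2) \<le> (s * (L2_norm M f)\<^sup>2) * (s * (cmod w)\<^sup>2)"
      using variation[of "of_real s * cnj w"] by (simp add: norm_mult power_mult_distrib power2_eq_square mult_ac)
    also have "\<dots> \<le> 1 * (s * (cmod w)\<^sup>2)"
      using s by (intro mult_right_mono) auto
    finally have "w = 0"
      using s by (simp add: mult_le_0_iff)
    then show ?thesis
      by (simp add: w_def)
  qed
  have "L2_norm M e \<le> C"
  proof -
    have "(\<lambda>n. cmod (L2_inner M (\<phi> n) e)) \<longlonglongrightarrow> cmod (L2_inner M e e)"
      by (intro tendsto_norm L2_inner_tendsto[OF VL2[OF \<phi>(1)] e(1) e])
    moreover have "(\<lambda>n. C * L2_norm M (\<phi> n)) \<longlonglongrightarrow> C * L2_norm M e"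
      by (intro tendsto_intros L2_norm_tendsto[OF VL2[OF \<phi>(1)] e])
    ultimately have "cmod (L2_inner M e e) \<le> C * L2_norm M e"
      by (rule LIMSEQ_le) (use lbound[OF \<phi>(1)] rep[OF \<phi>(1)] in auto)
    then show ?thesis
      using L2_norm_nonneg[of M e] C
      unfolding L2_inner_self norm_of_real power2_eq_square by (auto simp: mult_le_cancel_right)
  qed
  then show thesis
    by (rule that[OF e(1) _ rep \<phi>(1) e(2)])
qed

section \<open>Simultaneous limits along a filter\<close>

text \<open>
  Each \<open>a n\<close> is a point of a product of closed discs, which is compact by Tychonoff's theorem, so
  the points \<open>a n\<close> cluster at some \<open>l\<close> along \<open>G\<close>; pulling back the neighbourhoods of \<open>l\<close> refines
  \<open>G\<close> to \<open>F\<close>. A filter replaces a subsequence since the index set may be uncountable.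
\<close>

lemma bounded_family_cluster_filter:
  fixes a :: "'n \<Rightarrow> 'i \<Rightarrow> complex"
  assumes bounded: "\<And>i. bounded (range (\<lambda>n. a n i))" and G: "G \<noteq> bot"
  obtains F l where "F \<noteq> bot" "F \<le> G" "\<And>i. ((\<lambda>n. a n i) \<longlongrightarrow> l i) F"
proof -
  obtain B where B: "\<And>i n. cmod (a n i) \<le> B i"
    using bounded unfolding bounded_iff by (metis rangeI)
  define K where "K = Pi\<^sub>E UNIV (\<lambda>i. cball (0::complex) (B i))"
  have "compactin (product_topology (\<lambda>i. euclidean) UNIV) K"
    unfolding K_def compactin_PiE by simp
  then have "compact K"
    by (simp add: euclidean_product_topology)
  moreover have "filtermap a G \<noteq> bot"
    using G by (simp add: filtermap_bot_iff)
  moreover have "eventually (\<lambda>h. h \<in> K) (filtermap a G)"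
    using B by (auto simp: eventually_filtermap K_def intro!: always_eventually)
  ultimately obtain l where l: "inf (nhds l) (filtermap a G) \<noteq> bot"
    unfolding compact_filter by blast
  define F where "F = inf (filtercomap a (nhds l)) G"
  have "F \<noteq> bot"
  proof
    assume "F = bot"
    then obtain P Q where PQ: "eventually P (nhds l)" "eventually Q G" "\<And>n. P (a n) \<Longrightarrow> Q n \<Longrightarrow> False"
      unfolding F_def trivial_limit_def eventually_inf eventually_filtercomap by metis
    have "eventually (\<lambda>h. \<not> P h) (filtermap a G)"
      unfolding eventually_filtermap using PQ(2) by (rule eventually_mono) (use PQ(3) in blast)
    then have "eventually (\<lambda>_. False) (inf (nhds l) (filtermap a G))"
      using PQ(1) unfolding eventually_inf by blast
    with l show False by (simp add: trivial_limit_def)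
  qed
  moreover have "F \<le> G" by (simp add: F_def)
  moreover have "((\<lambda>n. a n i) \<longlongrightarrow> l i) F" for i
  proof -
    have "(a \<longlongrightarrow> l) F"
      unfolding F_def by (rule filterlim_mono[OF filterlim_filtercomap]) auto
    then show ?thesis
      by (rule continuous_on_tendsto_compose[where f = "\<lambda>h. h i", OF continuous_on_product_coordinates]) auto
  qed
  ultimately show thesis by (rule that)
qed

section \<open>Twisted averages\<close>

lemma continuous_in_L2:
  fixes f :: "'a::metric_space \<Rightarrow> complex"
  assumes "compact (UNIV :: 'a set)" "finite_measure \<mu>" "sets \<mu> = sets borel" "continuous_on UNIV f"
  shows "f \<in> L2_space \<mu>"
proof -
  interpret finite_measure \<mu> by fact
  have [measurable]: "f \<in> borel_measurable \<mu>"
    using borel_measurable_continuous_onI[OF assms(4)] assms(3) by (simp cong: measurable_cong_sets)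
  obtain B where B: "\<And>y. cmod (f y) \<le> B"
    using compact_imp_bounded[OF compact_continuous_image[OF assms(4,1)]] by (auto simp: bounded_iff)
  have "(cmod (f y))\<^sup>2 \<le> B\<^sup>2" for y
    using B by (intro power_mono) auto
  then have "integrable \<mu> (\<lambda>y. (cmod (f y))\<^sup>2)"
    by (intro integrable_const_bound[of _ "B\<^sup>2"]) auto
  then show ?thesis by (simp add: L2_space_def)
qed

lemma powi_minus_of_nat: "(\<xi>::complex) powi (- int j) = inverse \<xi> ^ j"
  by (simp add: power_int_minus power_inverse)

lemma twisted_avg_norm_le:
  assumes "cmod \<xi> = 1"
  shows "cmod (twisted_avg T \<xi> f n x) \<le> (\<Sum>j<n. cmod (f ((T ^^ j) x))) / of_nat n"
proof -
  have "cmod (\<Sum>j<n. \<xi> powi (- int j) * f ((T ^^ j) x)) \<le> (\<Sum>j<n. cmod (f ((T ^^ j) x)))"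
    using assms by (intro sum_norm_le) (simp add: powi_minus_of_nat norm_mult norm_power norm_inverse)
  then show ?thesis
    by (simp add: twisted_avg_def norm_divide divide_right_mono)
qed

lemma twisted_avg_add:
  "twisted_avg T \<xi> (\<lambda>y. f y + g y) n x = twisted_avg T \<xi> f n x + twisted_avg T \<xi> g n x"
  by (simp add: twisted_avg_def distrib_left sum.distrib add_divide_distrib)

lemma twisted_avg_scale:
  "twisted_avg T \<xi> (\<lambda>y. c * f y) n x = c * twisted_avg T \<xi> f n x"
  by (simp add: twisted_avg_def sum_distrib_left mult_ac)

text \<open>
  The term of \<open>f \<circ> T\<close> at \<open>j\<close> is \<open>\<xi>\<close> times the term of \<open>f\<close> at \<open>j + 1\<close>, so the difference telescopes
  and its boundary terms contribute at most \<open>2 B / n\<close>.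
\<close>

lemma twisted_avg_shift:
  assumes "cmod \<xi> = 1" "\<And>y. cmod (f y) \<le> B"
  shows "(\<lambda>n. twisted_avg T \<xi> (f \<circ> T) n x - \<xi> * twisted_avg T \<xi> f n x) \<longlonglongrightarrow> 0"
proof (rule Lim_null_comparison)
  have \<xi>: "\<xi> \<noteq> 0" using assms by auto
  define c where "c j = \<xi> * (inverse \<xi> ^ j * f ((T ^^ j) x))" for j
  have eq: "twisted_avg T \<xi> (f \<circ> T) n x - \<xi> * twisted_avg T \<xi> f n x = (c n - c 0) / of_nat n" for n
  proof -
    have "c (Suc j) - c j = inverse \<xi> ^ j * (f \<circ> T) ((T ^^ j) x) - \<xi> * (inverse \<xi> ^ j * f ((T ^^ j) x))" for j
      using \<xi> by (simp add: c_def)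
    then show ?thesis
      unfolding sum_lessThan_telescope[of c, symmetric] twisted_avg_def powi_minus_of_nat
      by (simp add: sum_subtractf sum_distrib_left diff_divide_distrib)
  qed
  have "cmod (c j) \<le> B" for j
    using assms by (simp add: c_def norm_mult norm_power norm_inverse)
  then have "cmod (c n - c 0) \<le> 2 * B" for n
    using norm_triangle_ineq4[of "c n" "c 0"] by (smt (verit))
  then show "\<forall>\<^sub>F n in sequentially. cmod (twisted_avg T \<xi> (f \<circ> T) n x - \<xi> * twisted_avg T \<xi> f n x) \<le> 2 * B / of_nat n"
    unfolding eq by (simp add: norm_divide divide_right_mono)
  show "(\<lambda>n. 2 * B / of_nat n) \<longlonglongrightarrow> 0"
    by (rule lim_const_over_n)
qed

text \<open>
  The averages are dominated by the averages of \<open>\<bar>f\<bar>\<close>, which tend to \<open>\<integral>\<bar>f\<bar> d\<mu>\<close> by genericity; on a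
  probability space this is at most the \<open>L\<^sup>2\<close>-norm.
\<close>

lemma twisted_avg_limit_bound:
  fixes f :: "'a::metric_space \<Rightarrow> complex"
  assumes compact: "compact (UNIV :: 'a set)" and \<mu>: "prob_space \<mu>" "sets \<mu> = sets borel"
    and generic: "generic_point T \<mu> x" and \<xi>: "cmod \<xi> = 1" and f: "continuous_on UNIV f"
    and F: "F \<noteq> bot" "F \<le> sequentially"
    and lim: "((\<lambda>n. twisted_avg T \<xi> f n x) \<longlongrightarrow> c) F"
  shows "cmod c \<le> L2_norm \<mu> f"
proof -
  interpret prob_space \<mu> by fact
  let ?abs = "\<lambda>y. complex_of_real (cmod (f y))"
  have cont: "continuous_on UNIV ?abs"
    by (intro continuous_intros f)
  have L2: "g \<in> L2_space \<mu>" if "continuous_on UNIV g" for g :: "'a \<Rightarrow> complex"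
    using continuous_in_L2[OF compact _ \<mu>(2) that] finite_measure_axioms by blast
  have "((\<lambda>n. (\<Sum>j<n. ?abs ((T ^^ j) x)) / of_nat n) \<longlongrightarrow> (LINT y|\<mu>. ?abs y)) F"
    using generic cont F(2) unfolding generic_point_def by (blast intro: tendsto_mono)
  then have "((\<lambda>n. cmod ((\<Sum>j<n. ?abs ((T ^^ j) x)) / of_nat n)) \<longlongrightarrow> cmod (LINT y|\<mu>. ?abs y)) F"
    by (rule tendsto_norm)
  moreover have "cmod ((\<Sum>j<n. ?abs ((T ^^ j) x)) / of_nat n) = (\<Sum>j<n. cmod (f ((T ^^ j) x))) / of_nat n" for n
    by (simp add: norm_divide sum_nonneg flip: of_real_sum)
  ultimately have "((\<lambda>n. (\<Sum>j<n. cmod (f ((T ^^ j) x))) / of_nat n) \<longlongrightarrow> cmod (LINT y|\<mu>. ?abs y)) F"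
    by simp
  then have "cmod c \<le> cmod (LINT y|\<mu>. ?abs y)"
    by (rule tendsto_le[OF F(1) _ tendsto_norm[OF lim]])
      (rule always_eventually, rule allI, rule twisted_avg_norm_le[OF \<xi>])
  also have "\<dots> = cmod (L2_inner \<mu> ?abs (\<lambda>_. 1))"
    by (simp add: L2_inner_def)
  also have "\<dots> \<le> L2_norm \<mu> ?abs * L2_norm \<mu> (\<lambda>_. 1)"
    by (intro L2_Cauchy_Schwarz L2 cont continuous_intros)
  also have "\<dots> = L2_norm \<mu> f"
    by (simp add: L2_norm_def prob_space)
  finally show ?thesis .
qed

section \<open>Eigenfunctions of the Koopman operator\<close>

lemma L2_koopman:
  assumes T: "T \<in> measurable M M" and inv: "distr M M T = M" and f: "f \<in> L2_space M"
  shows "f \<circ> T \<in> L2_space M" "L2_norm M (f \<circ> T) = L2_norm M f"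
proof -
  note [measurable] = T
  have [measurable]: "f \<in> borel_measurable M"
    using f by (auto simp: L2_space_def)
  have "integrable (distr M M T) (\<lambda>y. (cmod (f y))\<^sup>2)"
    using f by (simp add: inv L2_space_def)
  then have "integrable M (\<lambda>y. (cmod (f (T y)))\<^sup>2)"
    by (subst (asm) integrable_distr_eq) auto
  then show "f \<circ> T \<in> L2_space M"
    by (simp add: L2_space_def)
  have "(LINT y|M. (cmod (f (T y)))\<^sup>2) = (LINT y|distr M M T. (cmod (f y))\<^sup>2)"
    by (rule integral_distr[symmetric]) auto
  then show "L2_norm M (f \<circ> T) = L2_norm M f"
    by (simp add: L2_norm_def inv)
qed

text \<open>
  A weak eigenvalue equation, tested only against functions \<open>\<phi>\<^sub>n\<close> converging to \<open>e\<close>, suffices: in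
  the limit \<open>\<langle>e \<circ> T, e\<rangle> = \<xi> \<parallel>e\<parallel>\<^sup>2\<close>, so \<open>e \<circ> T\<close> and \<open>\<xi> e\<close>, both of norm \<open>\<parallel>e\<parallel>\<close>, have
  inner product \<open>\<parallel>e\<parallel>\<^sup>2\<close>, and expanding \<open>\<parallel>e \<circ> T - \<xi> e\<parallel>\<^sup>2\<close> gives \<open>0\<close>.
\<close>

lemma koopman_eigenvector_of_approximants:
  assumes T: "T \<in> measurable M M" and inv: "distr M M T = M"
    and \<phi>: "\<And>n. \<phi> n \<in> L2_space M" and e: "e \<in> L2_space M"
    and lim: "(\<lambda>n. L2_norm M (\<lambda>y. \<phi> n y - e y)) \<longlonglongrightarrow> 0"
    and \<xi>: "cmod \<xi> = 1"
    and equivariant: "\<And>n. L2_inner M (\<phi> n \<circ> T) e = \<xi> * L2_inner M (\<phi> n) e"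
  shows "AE y in M. koopman T e y = \<xi> * e y"
proof -
  note K = L2_koopman[OF T inv]
  have eT: "(\<lambda>y. e (T y)) \<in> L2_space M"
    using K(1)[OF e] by (simp add: o_def)
  have "L2_norm M (\<lambda>y. (\<phi> n \<circ> T) y - (e \<circ> T) y) = L2_norm M (\<lambda>y. \<phi> n y - e y)" for n
    using K(2)[OF L2_diff[OF \<phi> e], of n] by (simp add: o_def)
  then have "(\<lambda>n. L2_inner M (\<phi> n \<circ> T) e) \<longlonglongrightarrow> L2_inner M (e \<circ> T) e"
    using lim by (intro L2_inner_tendsto K(1) \<phi> e) simp
  moreover have "(\<lambda>n. L2_inner M (\<phi> n \<circ> T) e) \<longlonglongrightarrow> \<xi> * L2_inner M e e"
    unfolding equivariant by (intro tendsto_intros L2_inner_tendsto[OF \<phi> e e lim])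
  ultimately have "L2_inner M (e \<circ> T) e = \<xi> * L2_inner M e e"
    by (rule LIMSEQ_unique)
  then have "L2_inner M (\<lambda>y. e (T y)) (\<lambda>y. \<xi> * e y) = cnj \<xi> * (\<xi> * L2_inner M e e)"
    by (subst L2_inner_commute, subst L2_inner_scale_left)
      (simp add: L2_inner_commute[of M e "\<lambda>y. e (T y)"] o_def)
  also have "cnj \<xi> * (\<xi> * L2_inner M e e) = (\<xi> * cnj \<xi>) * L2_inner M e e"
    by (simp add: mult_ac)
  also have "\<dots> = of_real ((L2_norm M e)\<^sup>2)"
    using \<xi> by (simp add: complex_norm_square[symmetric] L2_inner_self)
  finally have "Re (L2_inner M (\<lambda>y. e (T y)) (\<lambda>y. \<xi> * e y)) = (L2_norm M e)\<^sup>2"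
    by simp
  moreover have "L2_norm M (\<lambda>y. e (T y)) = L2_norm M e"
    using K(2)[OF e] by (simp add: o_def)
  ultimately have "(L2_norm M (\<lambda>y. e (T y) - \<xi> * e y))\<^sup>2 = 0"
    using \<xi> by (subst L2_norm_sq_diff[OF eT L2_scale[OF e]]) (simp add: L2_norm_scale)
  then show ?thesis
    using L2_norm_eq_0_iff[OF L2_diff[OF eT L2_scale[OF e, of \<xi>]]] by (simp add: koopman_def)
qed

section \<open>The dichotomy\<close>

theorem lemma3p7:
  fixes T :: "'a::metric_space \<Rightarrow> 'a" and \<mu> :: "'a measure" and \<xi> :: complex and x :: 'a
  assumes "compact (UNIV :: 'a set)"
    and "homeomorphic_map euclidean euclidean T"
    and "\<mu> \<in> invariant_prob_measures T"
    and "\<xi> \<in> sphere 0 1"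
    and "generic_point T \<mu> x"
  shows "(\<forall>f. continuous_on UNIV f \<longrightarrow> twisted_lim_exists T \<xi> f x \<and> twisted_lim T \<xi> f x = 0) \<or>
    (koopman_eigenvalue T \<mu> \<xi> \<and>
     (\<exists>e. koopman_eigenfunction T \<mu> \<xi> e \<and> L2_norm \<mu> e \<le> 1 \<and>
        (\<forall>f. continuous_on UNIV f \<and> twisted_lim_exists T \<xi> f x \<longrightarrow>
           twisted_lim T \<xi> f x = L2_inner \<mu> f e)))"
proof (cases "\<forall>f. continuous_on UNIV f \<longrightarrow> (\<lambda>n. twisted_avg T \<xi> f n x) \<longlonglongrightarrow> 0")
  case True
  then show ?thesis
    by (auto simp: twisted_lim_exists_def twisted_lim_def convergent_def intro: limI)
next
  case False
  then obtain f\<^sub>0 where f\<^sub>0: "continuous_on UNIV f\<^sub>0" "\<not> (\<lambda>n. twisted_avg T \<xi> f\<^sub>0 n x) \<longlonglongrightarrow> 0"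
    by blast
  have \<mu>: "sets \<mu> = sets borel" "prob_space \<mu>" "distr \<mu> \<mu> T = \<mu>"
    using assms(3) by (auto simp: invariant_prob_measures_def)
  have \<xi>: "cmod \<xi> = 1"
    using assms(4) by simp
  have T: "continuous_on UNIV T"
    using homeomorphic_imp_continuous_map[OF assms(2)] by simp
  have T_meas: "T \<in> measurable \<mu> \<mu>"
    using borel_measurable_continuous_onI[OF T] \<mu>(1) by (simp cong: measurable_cong_sets)
  have L2: "f \<in> L2_space \<mu>" if "continuous_on UNIV f" for f :: "'a \<Rightarrow> complex"
    using continuous_in_L2[OF assms(1) prob_space.finite_measure[OF \<mu>(2)] \<mu>(1) that] .
  have bdd: "\<exists>B. \<forall>y. cmod (f y) \<le> B" if "continuous_on UNIV f" for f :: "'a \<Rightarrow> complex"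
    using compact_imp_bounded[OF compact_continuous_image[OF that assms(1)]] by (auto simp: bounded_iff)
  have contT: "continuous_on UNIV (f \<circ> T)" if "continuous_on UNIV f" for f :: "'a \<Rightarrow> complex"
    using T continuous_on_subset[OF that subset_UNIV] by (rule continuous_on_compose)
  obtain \<epsilon> where \<epsilon>: "0 < \<epsilon>" "\<exists>\<^sub>F n in sequentially. \<epsilon> \<le> cmod (twisted_avg T \<xi> f\<^sub>0 n x)"
    using f\<^sub>0(2) unfolding tendsto_iff by (auto simp: frequently_def not_le)
  define G where "G = inf sequentially (principal {n. \<epsilon> \<le> cmod (twisted_avg T \<xi> f\<^sub>0 n x)})"
  have "G \<noteq> bot"
    using \<epsilon>(2) by (simp add: G_def trivial_limit_def eventually_inf_principal frequently_def)
  \<comment> \<open>Cutting off at discontinuous functions, whose averages may be unbounded, lets the index set of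
    the family be the whole function type.\<close>
  define a where "a n f = (if continuous_on UNIV f then twisted_avg T \<xi> f n x else 0)" for n f
  have "bounded (range (\<lambda>n. a n f))" for f
  proof (cases "continuous_on UNIV f")
    case True
    then obtain B where B: "\<And>y. cmod (f y) \<le> B"
      using bdd by blast
    have "cmod (a n f) \<le> B" for n
    proof (cases "n = 0")
      case True
      moreover have "0 \<le> B"
        using B[of x] norm_ge_zero[of "f x"] by linarith
      ultimately show ?thesis by (simp add: a_def twisted_avg_def)
    next
      case False
      have "(\<Sum>j<n. cmod (f ((T ^^ j) x))) \<le> of_nat n * B"
        using sum_bounded_above[of "{..<n}" "\<lambda>j. cmod (f ((T ^^ j) x))" B] B by simp
      then show ?thesis
        using twisted_avg_norm_le[OF \<xi>, of T f n x] True False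
        by (simp add: a_def) (smt (verit, best) divide_le_eq mult.commute of_nat_0_less_iff)
    qed
    then show ?thesis by (auto simp: bounded_iff)
  qed (simp add: a_def)
  then obtain F l where F: "F \<noteq> bot" "F \<le> G" and lim: "\<And>f. ((\<lambda>n. a n f) \<longlongrightarrow> l f) F"
    using bounded_family_cluster_filter[OF _ \<open>G \<noteq> bot\<close>, of a] by metis
  then have l: "((\<lambda>n. twisted_avg T \<xi> f n x) \<longlongrightarrow> l f) F" if "continuous_on UNIV f" for f
    using lim[of f] that by (simp add: a_def)
  have Fseq: "F \<le> sequentially"
    using F(2) by (simp add: G_def)
  have l_unique: "l f = c" if "continuous_on UNIV f" "((\<lambda>n. twisted_avg T \<xi> f n x) \<longlongrightarrow> c) F" for f c
    using tendsto_unique[OF F(1) l that(2)] that(1) .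
  have "l f\<^sub>0 \<noteq> 0"
  proof -
    have "\<forall>\<^sub>F n in F. \<epsilon> \<le> cmod (twisted_avg T \<xi> f\<^sub>0 n x)"
      by (rule filter_leD[OF F(2)]) (simp add: G_def eventually_inf_principal)
    then have "\<epsilon> \<le> cmod (l f\<^sub>0)"
      using tendsto_lowerbound[OF tendsto_norm[OF l[OF f\<^sub>0(1)]]] F(1) by blast
    with \<epsilon>(1) show ?thesis by auto
  qed
  define V where "V = {f :: 'a \<Rightarrow> complex. continuous_on UNIV f}"
  obtain e \<phi> where e: "e \<in> L2_space \<mu>" "L2_norm \<mu> e \<le> 1"
    and rep: "\<And>f. f \<in> V \<Longrightarrow> l f = L2_inner \<mu> f e"
    and \<phi>: "\<And>n. \<phi> n \<in> V" "(\<lambda>n. L2_norm \<mu> (\<lambda>y. \<phi> n y - e y)) \<longlonglongrightarrow> 0"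
  proof (rule Riesz_representation_L2_subspace[of V \<mu> l 1])
    show "l (\<lambda>y. f y + g y) = l f + l g" if "f \<in> V" "g \<in> V" for f g
      using that unfolding V_def by (intro l_unique) (auto simp: twisted_avg_add intro!: tendsto_add l continuous_intros)
    show "l (\<lambda>y. c * f y) = c * l f" if "f \<in> V" for c f
      using that unfolding V_def by (intro l_unique) (auto simp: twisted_avg_scale intro!: tendsto_mult_left l continuous_intros)
    show "cmod (l f) \<le> 1 * L2_norm \<mu> f" if "f \<in> V" for f
      using twisted_avg_limit_bound[OF assms(1) \<mu>(2,1) assms(5) \<xi> _ F(1) Fseq l, of f] that by (simp add: V_def)
  qed (use L2 f\<^sub>0 in \<open>auto simp: V_def intro!: continuous_intros\<close>)
  have "AE y in \<mu>. koopman T e y = \<xi> * e y"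
  proof (rule koopman_eigenvector_of_approximants[OF T_meas \<mu>(3) _ e(1) \<phi>(2) \<xi>])
    fix n
    have cont: "continuous_on UNIV (\<phi> n)"
      using \<phi>(1) by (simp add: V_def)
    then show "\<phi> n \<in> L2_space \<mu>"
      by (rule L2)
    obtain B where B: "\<And>y. cmod (\<phi> n y) \<le> B"
      using bdd[OF cont] by blast
    have "((\<lambda>k. (twisted_avg T \<xi> (\<phi> n \<circ> T) k x - \<xi> * twisted_avg T \<xi> (\<phi> n) k x)
        + \<xi> * twisted_avg T \<xi> (\<phi> n) k x) \<longlongrightarrow> 0 + \<xi> * l (\<phi> n)) F"
      by (intro tendsto_add tendsto_mult_left l[OF cont] tendsto_mono[OF Fseq twisted_avg_shift[OF \<xi> B]])
    then have "l (\<phi> n \<circ> T) = \<xi> * l (\<phi> n)"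
      by (intro l_unique contT cont) simp
    then show "L2_inner \<mu> (\<phi> n \<circ> T) e = \<xi> * L2_inner \<mu> (\<phi> n) e"
      using rep[of "\<phi> n"] rep[of "\<phi> n \<circ> T"] contT[OF cont] cont by (simp add: V_def)
  qed
  moreover have "\<not> (AE y in \<mu>. e y = 0)"
  proof
    assume "AE y in \<mu>. e y = 0"
    then have "L2_norm \<mu> e = 0"
      using L2_norm_eq_0_iff[OF e(1)] by simp
    then have "L2_inner \<mu> f\<^sub>0 e = 0"
      using L2_Cauchy_Schwarz[OF L2[OF f\<^sub>0(1)] e(1)] by simp
    then show False
      using \<open>l f\<^sub>0 \<noteq> 0\<close> rep[of f\<^sub>0] f\<^sub>0(1) by (simp add: V_def)
  qed
  ultimately have eigen: "koopman_eigenfunction T \<mu> \<xi> e"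
    using e(1) by (simp add: koopman_eigenfunction_def)
  moreover have "twisted_lim T \<xi> f x = L2_inner \<mu> f e"
    if f: "continuous_on UNIV f" "twisted_lim_exists T \<xi> f x" for f
  proof -
    have "(\<lambda>n. twisted_avg T \<xi> f n x) \<longlonglongrightarrow> twisted_lim T \<xi> f x"
      using f(2) by (simp add: twisted_lim_exists_def twisted_lim_def convergent_LIMSEQ_iff)
    then have "l f = twisted_lim T \<xi> f x"
      by (intro l_unique f(1) tendsto_mono[OF Fseq])
    then show ?thesis
      using rep[of f] f(1) by (simp add: V_def)
  qed
  ultimately show ?thesis
    using e(2) unfolding koopman_eigenvalue_def by blast
qed

end
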